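(* Let $a\in(1/2,1)$, $h(x)=\max\{1-|x-1|,0\}$, and let $\mathcal C_a=\{\phi_t:t\in[0,1]^{\mathbb N}\}$ where $\phi_t(x)=\sum_{k\ge1}a^{k-1}t_k\,h(2^kx-2)$, $x\in\mathbb R$. For $\varepsilon>0$ set $$w_k=a^{k-1},\qquad n_k=\Bigl\lceil\frac{w_k}{2\varepsilon}\Bigr\rceil\qquad(k\ge1).$$ Then for every $\varepsilon>0$ only finitely many $n_k$ exceed $1$, and $$N(\varepsilon,\mathcal C_a)=\prod_{k\ge1}n_k,\qquad B_\varepsilon^*=\Bigl\lceil\sum_{k\ge1}\log_2n_k\Bigr\rceil,$$ where $B^*_\varepsilon$ is the minimum bit length of a deterministic fixed-length code for $\mathcal C_a$ with worst-case distortion at most $\varepsilon$. If $a\in\mathbb Q$, then $B_\varepsilon^*$ is attained by a mixed-radix code whose reconstructions are computed exactly on $\mathbb R$ by ReLU networks with rational parameters, of width $O(1)$ and with depth and number of parameters $O_a(1+\log_+\varepsilon^{-1})$, where $\log_+u:=\max\{\log_2u,0\}$. Moreover, for $X:=\log_2\varepsilon^{-1}>1$ and $\lambda:=\log_2a^{-1}$, $$H_\varepsilon(\mathcal C_a)=\frac{X^2}{2\lambda}+\Bigl(\frac12-\frac1\lambda\Bigr)X+O_a(1),$$ and $$0\le H_\varepsilon(\mathcal C_a)-\frac{(X-1)^2}{2\lambda}-\frac{X-1}2\le\frac\lambda8+\frac1{(1-a)\ln2}.$$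
   Context: For a compact function class $\mathcal C$ (functions on $\mathbb R$ with the uniform norm), $N(\varepsilon,\mathcal C)$ is the minimal number of closed uniform-norm balls of radius $\varepsilon$, with arbitrary bounded functions as centers, covering $\mathcal C$, and $H_\varepsilon(\mathcal C)=\log_2N(\varepsilon,\mathcal C)$. A deterministic fixed-length code of bit length $B$ is a pair consisting of an encoder $E:\mathcal C\to\{0,1\}^B$ and a decoder $R$ from $\{0,1\}^B$ to bounded functions; its worst-case distortion is $\sup_{f\in\mathcal C}\|f-R(E(f))\|_\infty$. The decoder and the values $a,\varepsilon$ are shared and not counted in the bit length. A mixed-radix code transmits the rank of a tuple of digits $(j_k)$ with $0\le j_k<n_k$ as an integer in $\{0,\dots,\prod_kn_k-1\}$. A ReLU network consists of affine maps separated by coordinatewise activations $t\mapsto\max\{t,0\}$ with an affine output layer; width is the largest hidden dimension, depth the number of hidden layers, and the parameter count includes all affine entries. $O_a$ denotes constants depending only on $a$. *)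

theory Defs
  imports
    "HOL-Analysis.Infinite_Products"
    "HOL-Library.Extended_Nonnegative_Real"
    "HOL-Library.FuncSet"
    "Jordan_Normal_Form.Matrix"
begin

subsection \<open>Uniform norm and covering numbers\<close>

text \<open>Extended-valued suprema and infima are used throughout, so that an unbounded difference
  has norm \<open>\<infinity>\<close> and an empty set of admissible sizes has infimum \<open>\<infinity>\<close>.\<close>

definition unif_norm :: "(real \<Rightarrow> real) \<Rightarrow> ennreal" where
  "unif_norm f = (SUP x. ennreal \<bar>f x\<bar>)"

definition unif_cball :: "(real \<Rightarrow> real) \<Rightarrow> real \<Rightarrow> (real \<Rightarrow> real) set" where
  "unif_cball g r = {f. unif_norm (\<lambda>x. f x - g x) \<le> ennreal r}"

definition covering_number :: "real \<Rightarrow> (real \<Rightarrow> real) set \<Rightarrow> enat" where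
  "covering_number \<epsilon> C =
     Inf {enat (card S) | S. finite S \<and> (\<forall>g\<in>S. bounded (range g)) \<and> C \<subseteq> (\<Union>g\<in>S. unif_cball g \<epsilon>)}"

text \<open>Meaningful only for a finite covering number.\<close>

definition metric_entropy :: "real \<Rightarrow> (real \<Rightarrow> real) set \<Rightarrow> real" where
  "metric_entropy \<epsilon> C = log 2 (real (the_enat (covering_number \<epsilon> C)))"


subsection \<open>Fixed-length codes\<close>

type_synonym encoder = "(real \<Rightarrow> real) \<Rightarrow> bool list"
type_synonym decoder = "bool list \<Rightarrow> real \<Rightarrow> real"

definition fixed_length_code :: "nat \<Rightarrow> (real \<Rightarrow> real) set \<Rightarrow> encoder \<Rightarrow> decoder \<Rightarrow> bool" where
  "fixed_length_code B C E R \<longleftrightarrow>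
     (\<forall>f\<in>C. length (E f) = B) \<and> (\<forall>b. length b = B \<longrightarrow> bounded (range (R b)))"

definition distortion :: "(real \<Rightarrow> real) set \<Rightarrow> encoder \<Rightarrow> decoder \<Rightarrow> ennreal" where
  "distortion C E R = (SUP f\<in>C. unif_norm (\<lambda>x. f x - R (E f) x))"

definition min_code_length :: "real \<Rightarrow> (real \<Rightarrow> real) set \<Rightarrow> enat" where
  "min_code_length \<epsilon> C =
     Inf {enat B | B. \<exists>E R. fixed_length_code B C E R \<and> distortion C E R \<le> ennreal \<epsilon>}"


subsection \<open>Mixed-radix codes\<close>

text \<open>Radices and digits are indexed by \<open>k \<ge> 1\<close>.  Positions with radix \<open>1\<close> carry the digit \<open>0\<close>,
  so if only finitely many radices exceed \<open>1\<close>, the infinite tuples below are in effect finite.\<close>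

definition digit_tuples :: "(nat \<Rightarrow> nat) \<Rightarrow> (nat \<Rightarrow> nat) set" where
  "digit_tuples n = (\<Pi>\<^sub>E k\<in>{1..}. {..<n k})"

definition mixed_radix_rank :: "(nat \<Rightarrow> nat) \<Rightarrow> (nat \<Rightarrow> nat) \<Rightarrow> nat" where
  "mixed_radix_rank n j = (\<Sum>k | 1 \<le> k \<and> 1 < n k. j k * (\<Prod>i\<in>{1..<k}. n i))"

definition binary_word :: "nat \<Rightarrow> nat \<Rightarrow> bool list" where
  "binary_word B r = map (bit r) [0..<B]"

text \<open>The encoder transmits the rank of the digit tuple \<open>J f\<close>; the decoder recovers the tuple
  from the rank and outputs the reconstruction \<open>D j\<close>.  Words that are not ranks are never sent.\<close>

definition mixed_radix_code ::
  "(nat \<Rightarrow> nat) \<Rightarrow> nat \<Rightarrow> (real \<Rightarrow> real) set \<Rightarrow> ((real \<Rightarrow> real) \<Rightarrow> nat \<Rightarrow> nat) \<Rightarrow>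
   ((nat \<Rightarrow> nat) \<Rightarrow> real \<Rightarrow> real) \<Rightarrow> encoder \<Rightarrow> decoder \<Rightarrow> bool" where
  "mixed_radix_code n B C J D E R \<longleftrightarrow>
     fixed_length_code B C E R \<and>
     (\<forall>f\<in>C. J f \<in> digit_tuples n \<and> E f = binary_word B (mixed_radix_rank n (J f))) \<and>
     (\<forall>j\<in>digit_tuples n. mixed_radix_rank n j < 2 ^ B \<and>
        R (binary_word B (mixed_radix_rank n j)) = D j)"


subsection \<open>ReLU networks\<close>

type_synonym affine_layer = "real mat \<times> real vec"

text \<open>The hidden layers, in the order of application, and the affine output layer.\<close>

type_synonym relu_net = "affine_layer list \<times> affine_layer"

definition apply_affine :: "affine_layer \<Rightarrow> real vec \<Rightarrow> real vec" where
  "apply_affine L v = fst L *\<^sub>v v + snd L"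

definition relu :: "real vec \<Rightarrow> real vec" where
  "relu v = map_vec (\<lambda>t. max t 0) v"

definition net_layers :: "relu_net \<Rightarrow> affine_layer list" where
  "net_layers N = fst N @ [snd N]"

fun composable :: "nat \<Rightarrow> affine_layer list \<Rightarrow> nat \<Rightarrow> bool" where
  "composable d [] d' \<longleftrightarrow> d = d'"
| "composable d ((A, b) # Ls) d' \<longleftrightarrow>
     dim_col A = d \<and> dim_vec b = dim_row A \<and> composable (dim_row A) Ls d'"

definition scalar_net :: "relu_net \<Rightarrow> bool" where
  "scalar_net N \<longleftrightarrow> composable 1 (net_layers N) 1"

definition net_fun :: "relu_net \<Rightarrow> real \<Rightarrow> real" where
  "net_fun N x =
     vec_index (apply_affine (snd N) (fold (\<lambda>L v. relu (apply_affine L v)) (fst N) (vec 1 (\<lambda>_. x)))) 0"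

definition net_width :: "relu_net \<Rightarrow> nat" where
  "net_width N = Max (insert 0 ((\<lambda>L. dim_row (fst L)) ` set (fst N)))"

definition net_depth :: "relu_net \<Rightarrow> nat" where
  "net_depth N = length (fst N)"

definition net_params :: "relu_net \<Rightarrow> nat" where
  "net_params N = (\<Sum>(A, b)\<leftarrow>net_layers N. dim_row A * dim_col A + dim_vec b)"

definition rational_net :: "relu_net \<Rightarrow> bool" where
  "rational_net N \<longleftrightarrow>
     (\<forall>(A, b)\<in>set (net_layers N). elements_mat A \<subseteq> \<rat> \<and> (\<forall>i<dim_vec b. vec_index b i \<in> \<rat>))"


subsection \<open>The function class\<close>

definition hat :: "real \<Rightarrow> real" where
  "hat x = max (1 - \<bar>x - 1\<bar>) 0"

definition weight :: "real \<Rightarrow> nat \<Rightarrow> real" where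
  "weight a k = a ^ (k - 1)"

text \<open>Indices \<open>k \<ge> 1\<close> are written \<open>Suc k\<close> under infinite sums and products.\<close>

definition bump_series :: "real \<Rightarrow> (nat \<Rightarrow> real) \<Rightarrow> real \<Rightarrow> real" where
  "bump_series a t x = (\<Sum>k. weight a (Suc k) * t (Suc k) * hat (2 ^ Suc k * x - 2))"

definition bump_class :: "real \<Rightarrow> (real \<Rightarrow> real) set" where
  "bump_class a = {bump_series a t | t. \<forall>k\<ge>1. t k \<in> {0..1}}"

definition radix :: "real \<Rightarrow> real \<Rightarrow> nat \<Rightarrow> nat" where
  "radix a \<epsilon> k = nat \<lceil>weight a k / (2 * \<epsilon>)\<rceil>"

definition log_plus :: "real \<Rightarrow> real" where
  "log_plus u = max (log 2 u) 0"

end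

theory Submission
  imports Defs
begin

text \<open>The bumps have disjoint supports and \<open>t\<^sub>k\<close> is read off at the peak of the \<open>k\<close>-th bump, so the
  class is isometric to the product of the intervals \<open>[0, w\<^sub>k]\<close> with the maximum norm. An interval of
  length \<open>w\<^sub>k\<close> contains \<open>n\<^sub>k\<close> equidistant points at distance greater than \<open>2\<epsilon>\<close> (packing) and
  is covered by the \<open>n\<^sub>k\<close> intervals of radius \<open>w\<^sub>k / (2 n\<^sub>k) \<le> \<epsilon>\<close> (covering), so the covering
  number is exactly the product. The levels with \<open>n\<^sub>k = 1\<close> are reconstructed by a single ramp, so that
  every reconstruction is a sum of \<open>O(log (1/\<epsilon>))\<close> ReLU units, which a network of width 5 evaluates one
  unit per layer.\<close>

section \<open>Covering numbers and fixed-length codes\<close>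

lemma unif_norm_le_iff:
  assumes "0 \<le> r"
  shows "unif_norm f \<le> ennreal r \<longleftrightarrow> (\<forall>x. \<bar>f x\<bar> \<le> r)"
  using assms by (simp add: unif_norm_def SUP_le_iff)

lemma mem_unif_cball_iff:
  assumes "0 \<le> r"
  shows "f \<in> unif_cball g r \<longleftrightarrow> (\<forall>x. \<bar>f x - g x\<bar> \<le> r)"
  using assms by (simp add: unif_cball_def unif_norm_le_iff)

lemma covering_number_le:
  assumes "finite S" "\<And>g. g \<in> S \<Longrightarrow> bounded (range g)" "C \<subseteq> (\<Union>g\<in>S. unif_cball g \<epsilon>)"
  shows "covering_number \<epsilon> C \<le> enat (card S)"
  unfolding covering_number_def by (rule Inf_lower) (use assms in blast)

text \<open>Two points of \<open>P\<close> in one ball of radius \<epsilon> would differ by at most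
  2 \<epsilon> everywhere, so assigning to each point a ball that contains it is injective.\<close>

lemma covering_number_ge_packing:
  assumes "0 \<le> \<epsilon>" "finite P" "P \<subseteq> C"
    and sep: "\<And>f g. f \<in> P \<Longrightarrow> g \<in> P \<Longrightarrow> f \<noteq> g \<Longrightarrow> \<exists>x. \<bar>f x - g x\<bar> > 2 * \<epsilon>"
  shows "enat (card P) \<le> covering_number \<epsilon> C"
  unfolding covering_number_def
proof (rule Inf_greatest, clarsimp)
  fix S :: "(real \<Rightarrow> real) set"
  assume S: "finite S" "C \<subseteq> (\<Union>g\<in>S. unif_cball g \<epsilon>)"
  have "\<forall>f\<in>P. \<exists>g\<in>S. f \<in> unif_cball g \<epsilon>" using S assms by blast
  then obtain c where c: "\<And>f. f \<in> P \<Longrightarrow> c f \<in> S" "\<And>f. f \<in> P \<Longrightarrow> f \<in> unif_cball (c f) \<epsilon>"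
    by metis
  have "inj_on c P"
  proof (rule inj_onI, rule ccontr)
    fix f g assume fg: "f \<in> P" "g \<in> P" "c f = c g" "f \<noteq> g"
    then obtain x where x: "\<bar>f x - g x\<bar> > 2 * \<epsilon>" using sep by blast
    have "\<bar>f x - c f x\<bar> \<le> \<epsilon>" "\<bar>g x - c f x\<bar> \<le> \<epsilon>"
      using c(2)[OF fg(1)] c(2)[OF fg(2)] fg(3) assms(1) by (auto simp: mem_unif_cball_iff)
    with x show False by linarith
  qed
  then show "card P \<le> card S" using c(1) S(1) by (meson card_inj_on_le image_subsetI)
qed

lemma distortion_le_iff:
  assumes "0 \<le> \<epsilon>"
  shows "distortion C E R \<le> ennreal \<epsilon> \<longleftrightarrow> (\<forall>f\<in>C. \<forall>x. \<bar>f x - R (E f) x\<bar> \<le> \<epsilon>)"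
  using assms by (simp add: distortion_def SUP_le_iff unif_norm_le_iff)

text \<open>The decoded words of length \<open>B\<close> are the centers of a cover, and there are
  at most \<open>2 ^ B\<close> of them.\<close>

lemma covering_number_le_code:
  assumes "0 \<le> \<epsilon>" and code: "fixed_length_code B C E R" and dist: "distortion C E R \<le> ennreal \<epsilon>"
  shows "covering_number \<epsilon> C \<le> enat (2 ^ B)"
proof -
  let ?W = "{b :: bool list. length b = B}"
  have card_W: "card ?W = 2 ^ B" and fin: "finite ?W"
    using card_lists_length_eq[of "UNIV :: bool set" B] finite_lists_length_eq[of "UNIV :: bool set" B]
    by auto
  have "C \<subseteq> (\<Union>g\<in>R ` ?W. unif_cball g \<epsilon>)"
    using code dist assms(1)
    by (fastforce simp: fixed_length_code_def distortion_le_iff mem_unif_cball_iff)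
  moreover have "\<And>g. g \<in> R ` ?W \<Longrightarrow> bounded (range g)"
    using code by (auto simp: fixed_length_code_def)
  ultimately have "covering_number \<epsilon> C \<le> enat (card (R ` ?W))"
    using fin by (intro covering_number_le) auto
  also have "\<dots> \<le> enat (2 ^ B)" using card_image_le[OF fin, of R] card_W by simp
  finally show ?thesis .
qed

text \<open>Every admissible code has \<open>M \<le> 2 ^ B\<close>; since \<open>B\<close> is an
  integer, the logarithm may be rounded up, and the given code attains this bound.\<close>

lemma min_code_length_eqI:
  assumes "0 \<le> \<epsilon>" "covering_number \<epsilon> C = enat M" "0 < M"
    and "fixed_length_code (nat \<lceil>log 2 (real M)\<rceil>) C E R" "distortion C E R \<le> ennreal \<epsilon>"
  shows "min_code_length \<epsilon> C = enat (nat \<lceil>log 2 (real M)\<rceil>)"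
proof (rule antisym)
  show "min_code_length \<epsilon> C \<le> enat (nat \<lceil>log 2 (real M)\<rceil>)"
    unfolding min_code_length_def by (rule Inf_lower) (use assms in blast)
  show "enat (nat \<lceil>log 2 (real M)\<rceil>) \<le> min_code_length \<epsilon> C"
    unfolding min_code_length_def
  proof (rule Inf_greatest, clarify)
    fix B E R assume "fixed_length_code B C E R" "distortion C E R \<le> ennreal \<epsilon>"
    then have "M \<le> 2 ^ B" using covering_number_le_code[OF assms(1)] assms(2) by fastforce
    then have "real M \<le> 2 ^ B" by (metis of_nat_le_iff of_nat_numeral of_nat_power)
    then have "log 2 (real M) \<le> log 2 (2 ^ B)" using assms(3) by (subst log_le_cancel_iff) auto
    then have "log 2 (real M) \<le> real B" by simp
    then show "enat (nat \<lceil>log 2 (real M)\<rceil>) \<le> enat B" by simp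
  qed
qed

lemma le_two_power_ceiling_log:
  assumes "0 < M"
  shows "M \<le> 2 ^ nat \<lceil>log 2 (real M)\<rceil>"
proof -
  have "real M = 2 powr (log 2 (real M))" using assms by simp
  also have "\<dots> \<le> 2 powr real (nat \<lceil>log 2 (real M)\<rceil>)"
    by (intro powr_mono) (auto simp: real_nat_ceiling_ge)
  also have "\<dots> = real (2 ^ nat \<lceil>log 2 (real M)\<rceil>)" by (simp add: powr_realpow)
  finally show ?thesis by (simp only: of_nat_le_iff)
qed

section \<open>Mixed-radix ranks\<close>

text \<open>Induction from the lowest digit: the lower part stays below the product of its radices,
  and the top digit adds at most \<open>n (Suc m) - 1\<close> copies of that product.\<close>

lemma mixed_radix_sum_less:
  fixes n j :: "nat \<Rightarrow> nat"
  assumes "\<And>k. k \<in> {1..m} \<Longrightarrow> j k < n k"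
  shows "(\<Sum>k=1..m. j k * (\<Prod>i\<in>{1..<k}. n i)) < (\<Prod>k=1..m. n k)"
  using assms
proof (induction m)
  case (Suc m)
  let ?P = "\<Prod>k=1..m. n k"
  have "(\<Sum>k=1..Suc m. j k * (\<Prod>i\<in>{1..<k}. n i)) =
      (\<Sum>k=1..m. j k * (\<Prod>i\<in>{1..<k}. n i)) + j (Suc m) * ?P"
    by (simp add: atLeastLessThanSuc_atLeastAtMost)
  also have "\<dots> < ?P + j (Suc m) * ?P" using Suc by simp
  also have "\<dots> = Suc (j (Suc m)) * ?P" by simp
  also have "\<dots> \<le> n (Suc m) * ?P" using Suc.prems[of "Suc m"] by (intro mult_right_mono) auto
  finally show ?case by (simp add: mult.commute)
qed simp

text \<open>Reduction modulo the product of the lower radices isolates the lower part; then the top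
  digits agree by cancellation and the others by induction.\<close>

lemma mixed_radix_sum_inj:
  fixes n i j :: "nat \<Rightarrow> nat"
  assumes "\<And>k. k \<in> {1..m} \<Longrightarrow> i k < n k" "\<And>k. k \<in> {1..m} \<Longrightarrow> j k < n k"
    and "(\<Sum>k=1..m. i k * (\<Prod>i\<in>{1..<k}. n i)) = (\<Sum>k=1..m. j k * (\<Prod>i\<in>{1..<k}. n i))"
    and "k \<in> {1..m}"
  shows "i k = j k"
  using assms
proof (induction m)
  case (Suc m)
  let ?P = "\<Prod>k=1..m. n k" and ?s = "\<lambda>i. \<Sum>k=1..m. i k * (\<Prod>i\<in>{1..<k}. n i)"
  have i: "?s i < ?P" and j: "?s j < ?P"
    by (rule mixed_radix_sum_less, rule Suc.prems, simp)+
  have eq: "?s i + i (Suc m) * ?P = ?s j + j (Suc m) * ?P"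
    using Suc.prems(3) by (simp add: atLeastLessThanSuc_atLeastAtMost)
  have "?s i = (?s i + i (Suc m) * ?P) mod ?P" using i by simp
  also have "\<dots> = ?s j" unfolding eq using j by simp
  finally have s: "?s i = ?s j" .
  have "?P \<noteq> 0" using i by linarith
  moreover have "i (Suc m) * ?P = j (Suc m) * ?P" using eq unfolding s by (simp only: add_left_cancel)
  ultimately have "i (Suc m) = j (Suc m)" by (rule mult_right_cancel[THEN iffD1])
  moreover have "i k = j k" if "k \<in> {1..m}"
    by (rule Suc.IH[OF _ _ s that]; rule Suc.prems; simp)
  ultimately show ?case using Suc.prems(4) by (cases "k = Suc m") auto
qed simp

lemma inj_on_binary_word: "inj_on (binary_word B) {..<2 ^ B}"
proof (rule inj_onI)
  fix r s :: nat
  assume rs: "r \<in> {..<2 ^ B}" "s \<in> {..<2 ^ B}" and eq: "binary_word B r = binary_word B s"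
  have "bit r i = bit s i" if "i < B" for i
    using arg_cong[OF eq, of "\<lambda>w. w ! i"] that by (simp add: binary_word_def)
  then have "take_bit B r = take_bit B s" by (simp add: bit_eq_iff bit_take_bit_iff) blast
  then show "r = s" using rs by (simp add: take_bit_nat_eq_self)
qed

text \<open>The radices above 1 form an initial segment ending at \<open>m\<close>. All other digits
  are forced to be 0, so infinite digit tuples amount to tuples on \<open>{1..m}\<close>.\<close>

locale finite_radices =
  fixes n :: "nat \<Rightarrow> nat" and m :: nat
  assumes radix_pos: "\<And>k. 1 \<le> k \<Longrightarrow> 0 < n k"
    and radix_gt_1_iff: "\<And>k. 1 \<le> k \<Longrightarrow> 1 < n k \<longleftrightarrow> k \<le> m"
begin

lemma radices_gt_1: "{k. 1 \<le> k \<and> 1 < n k} = {1..m}"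
  using radix_gt_1_iff by auto

lemma radix_eq_1: "m < k \<Longrightarrow> n k = 1"
  using radix_gt_1_iff[of k] radix_pos[of k] by (cases k) auto

lemma digit_tupleD:
  assumes "j \<in> digit_tuples n"
  shows "1 \<le> k \<Longrightarrow> j k < n k" and "m < k \<Longrightarrow> j k = 0" and "j 0 = undefined"
proof -
  show less: "j k < n k" if "1 \<le> k" for k using assms that by (auto simp: digit_tuples_def)
  show "j k = 0" if "m < k" for k using less[of k] radix_eq_1[OF that] that by simp
  show "j 0 = undefined" using assms by (auto simp: digit_tuples_def PiE_def extensional_def)
qed

lemma digit_tuples_eqI:
  assumes "i \<in> digit_tuples n" "j \<in> digit_tuples n" "\<And>k. k \<in> {1..m} \<Longrightarrow> i k = j k"
  shows "i = j"
proof
  fix k show "i k = j k"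
    using assms digit_tupleD(2,3)[OF assms(1)] digit_tupleD(2,3)[OF assms(2)]
    by (cases "k = 0"; cases "k \<le> m") auto
qed

lemma mixed_radix_rank_eq:
  "mixed_radix_rank n j = (\<Sum>k=1..m. j k * (\<Prod>i\<in>{1..<k}. n i))"
  unfolding mixed_radix_rank_def radices_gt_1 ..

lemma mixed_radix_rank_less:
  "j \<in> digit_tuples n \<Longrightarrow> mixed_radix_rank n j < (\<Prod>k=1..m. n k)"
  unfolding mixed_radix_rank_eq by (intro mixed_radix_sum_less digit_tupleD) auto

lemma inj_on_mixed_radix_rank: "inj_on (mixed_radix_rank n) (digit_tuples n)"
proof (intro inj_onI digit_tuples_eqI)
  fix i j k assume "i \<in> digit_tuples n" "j \<in> digit_tuples n" "k \<in> {1..m}"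
    and "mixed_radix_rank n i = mixed_radix_rank n j"
  then show "i k = j k"
    unfolding mixed_radix_rank_eq by (intro mixed_radix_sum_inj[of m i n j k] digit_tupleD) auto
qed

lemma bij_betw_restrict_digit_tuples:
  "bij_betw (\<lambda>j. restrict j {1..m}) (digit_tuples n) (\<Pi>\<^sub>E k\<in>{1..m}. {..<n k})"
proof (rule bij_betw_imageI)
  show "inj_on (\<lambda>j. restrict j {1..m}) (digit_tuples n)"
    by (intro inj_onI digit_tuples_eqI; assumption?) (metis restrict_apply')
  show "(\<lambda>j. restrict j {1..m}) ` digit_tuples n = (\<Pi>\<^sub>E k\<in>{1..m}. {..<n k})"
  proof (intro equalityI subsetI)
    fix j assume j: "j \<in> (\<Pi>\<^sub>E k\<in>{1..m}. {..<n k})"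
    \<comment> \<open>Position 0 lies outside the index set, where extensional tuples are
      \<open>undefined\<close>; positions beyond \<open>m\<close> have radix 1 and so digit
      0.\<close>
    let ?i = "\<lambda>k. if k \<in> {1..m} then j k else if k = 0 then undefined else 0"
    have "?i \<in> digit_tuples n"
      using j radix_pos by (auto simp: digit_tuples_def PiE_def extensional_def Pi_def)
    moreover have "restrict ?i {1..m} = j"
      using j by (auto simp: PiE_def extensional_def restrict_def)
    ultimately show "j \<in> (\<lambda>j. restrict j {1..m}) ` digit_tuples n" by (intro image_eqI[of _ _ ?i]) simp_all
  next
    fix j assume "j \<in> (\<lambda>j. restrict j {1..m}) ` digit_tuples n"
    then show "j \<in> (\<Pi>\<^sub>E k\<in>{1..m}. {..<n k})"
      using digit_tupleD(1) by (auto simp: PiE_def)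
  qed
qed

lemma card_digit_tuples: "card (digit_tuples n) = (\<Prod>k=1..m. n k)"
  using bij_betw_same_card[OF bij_betw_restrict_digit_tuples] by (simp add: card_PiE)

lemma finite_digit_tuples: "finite (digit_tuples n)"
  using bij_betw_finite[OF bij_betw_restrict_digit_tuples] by (simp add: finite_PiE)

lemma mixed_radix_code_exists:
  assumes J: "\<And>f. f \<in> C \<Longrightarrow> J f \<in> digit_tuples n"
    and D: "\<And>j. j \<in> digit_tuples n \<Longrightarrow> bounded (range (D j))"
    and B: "(\<Prod>k=1..m. n k) \<le> 2 ^ B"
  obtains E R where "mixed_radix_code n B C J D E R" "\<And>f. f \<in> C \<Longrightarrow> R (E f) = D (J f)"
proof -
  let ?T = "digit_tuples n" and ?w = "\<lambda>j. binary_word B (mixed_radix_rank n j)"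
  have less: "mixed_radix_rank n j < 2 ^ B" if "j \<in> ?T" for j
    using mixed_radix_rank_less[OF that] B by linarith
  have "inj_on ?w ?T"
    using comp_inj_on[OF inj_on_mixed_radix_rank inj_on_subset[OF inj_on_binary_word[of B]]] less
    by (auto simp: o_def)
  \<comment> \<open>Words that are no ranks decode to the zero function, which keeps every output
    bounded.\<close>
  define R where "R b = (if b \<in> ?w ` ?T then D (the_inv_into ?T ?w b) else (\<lambda>_. 0))" for b
  have R: "R (?w j) = D j" if "j \<in> ?T" for j
    using that the_inv_into_f_f[OF \<open>inj_on ?w ?T\<close> that] by (auto simp: R_def)
  have "bounded (range (R b))" for b
    using D the_inv_into_into[OF \<open>inj_on ?w ?T\<close> _ subset_refl] by (auto simp: R_def)
  then have "mixed_radix_code n B C J D (\<lambda>f. ?w (J f)) R"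
    using J R less by (auto simp: mixed_radix_code_def fixed_length_code_def binary_word_def)
  then show thesis using that R J by blast
qed

end

section \<open>Sums of ReLU units as deep narrow networks\<close>

text \<open>The network computes \<open>\<Sum>i\<le>n. c i * max (p i * x + q i) 0\<close> serially: its hidden state
  consists of the positive and negative parts of \<open>x\<close> and of the partial sum before the
  current unit, and of the current unit.\<close>

definition unit_sum :: "(nat \<Rightarrow> real) \<Rightarrow> (nat \<Rightarrow> real) \<Rightarrow> (nat \<Rightarrow> real) \<Rightarrow> nat \<Rightarrow> real \<Rightarrow> real" where
  "unit_sum p q c n x = (\<Sum>i<n. c i * max (p i * x + q i) 0)"

definition unit_state :: "(nat \<Rightarrow> real) \<Rightarrow> (nat \<Rightarrow> real) \<Rightarrow> (nat \<Rightarrow> real) \<Rightarrow> nat \<Rightarrow> real \<Rightarrow> real vec" where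
  "unit_state p q c n x = vec_of_list
     [max x 0, max (- x) 0, max (unit_sum p q c n x) 0, max (- unit_sum p q c n x) 0,
      max (p n * x + q n) 0]"

definition first_layer :: "real \<Rightarrow> real \<Rightarrow> affine_layer" where
  "first_layer p q = (mat_of_rows_list 1 [[1], [-1], [0], [0], [p]], vec_of_list [0, 0, 0, 0, q])"

text \<open>The first two entries are nonnegative and pass through the activation unchanged. Rows
  three and four add the pending unit, weighted by \<open>c\<close>, to the partial sum and to its
  negative; the last row rebuilds \<open>x\<close> from its two parts to form the next unit.\<close>

definition step_layer :: "real \<Rightarrow> real \<Rightarrow> real \<Rightarrow> affine_layer" where
  "step_layer c p q =
     (mat_of_rows_list 5
        [[1, 0, 0, 0, 0], [0, 1, 0, 0, 0], [0, 0, 1, -1, c], [0, 0, -1, 1, -c], [p, -p, 0, 0, 0]],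
      vec_of_list [0, 0, 0, 0, q])"

definition output_layer :: "real \<Rightarrow> affine_layer" where
  "output_layer c = (mat_of_rows_list 5 [[0, 0, 1, -1, c]], vec_of_list [0])"

text \<open>A unit is formed in one layer and added in the next, so the output layer adds the last
  one and the network sums \<open>n + 1\<close> units.\<close>

definition unit_net :: "(nat \<Rightarrow> real) \<Rightarrow> (nat \<Rightarrow> real) \<Rightarrow> (nat \<Rightarrow> real) \<Rightarrow> nat \<Rightarrow> relu_net" where
  "unit_net p q c n =
     (first_layer (p 0) (q 0) # map (\<lambda>i. step_layer (c i) (p (Suc i)) (q (Suc i))) [0..<n],
      output_layer (c n))"

lemma less_5_cases: "i < 5 \<Longrightarrow> i = 0 \<or> i = 1 \<or> i = 2 \<or> i = 3 \<or> i = (4::nat)"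
  by linarith

lemma sum_lessThan_5: "(\<Sum>i = 0..<5. f i) = f 0 + f 1 + f 2 + f 3 + f (4::nat)"
  by (simp add: eval_nat_numeral)

lemma max_minus_max_uminus: "max t 0 - max (- t) 0 = (t :: real)"
  by (simp add: max_def)

lemma dim_unit_state [simp]: "dim_vec (unit_state p q c n x) = 5"
  by (simp add: unit_state_def)

lemma unit_state_nth:
  "unit_state p q c n x $ 0 = max x 0"
  "unit_state p q c n x $ 1 = max (- x) 0"
  "unit_state p q c n x $ 2 = max (unit_sum p q c n x) 0"
  "unit_state p q c n x $ 3 = max (- unit_sum p q c n x) 0"
  "unit_state p q c n x $ 4 = max (p n * x + q n) 0"
  unfolding unit_state_def vec_of_list_index by simp_all

lemma unit_sum_Suc: "unit_sum p q c (Suc n) x = unit_sum p q c n x + c n * max (p n * x + q n) 0"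
  by (simp add: unit_sum_def)

lemma apply_affine_nth:
  assumes "i < dim_row (fst L)" "dim_vec (snd L) = dim_row (fst L)" "dim_vec v = dim_col (fst L)"
  shows "apply_affine L v $ i = (\<Sum>j = 0..<dim_vec v. fst L $$ (i, j) * v $ j) + snd L $ i"
  using assms by (simp add: apply_affine_def scalar_prod_def)

lemma dim_layers [simp]:
  "dim_row (fst (first_layer p q)) = 5" "dim_col (fst (first_layer p q)) = 1"
  "dim_vec (snd (first_layer p q)) = 5"
  "dim_row (fst (step_layer c p q)) = 5" "dim_col (fst (step_layer c p q)) = 5"
  "dim_vec (snd (step_layer c p q)) = 5"
  "dim_row (fst (output_layer c)) = 1" "dim_col (fst (output_layer c)) = 5"
  "dim_vec (snd (output_layer c)) = 1"
  by (simp_all add: first_layer_def step_layer_def output_layer_def mat_of_rows_list_def)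

lemma relu_first_layer:
  "relu (apply_affine (first_layer (p 0) (q 0)) (vec 1 (\<lambda>_. x))) = unit_state p q c 0 x"
  (is "relu ?v = ?r")
proof (rule eq_vecI)
  show "dim_vec (relu ?v) = dim_vec ?r" by (simp add: relu_def apply_affine_def)
  fix i assume "i < dim_vec ?r"
  then have i: "i < 5" by simp
  then have "?v $ i = [x, - x, 0, 0, p 0 * x + q 0] ! i"
    by (auto dest!: less_5_cases simp: apply_affine_nth)
       (auto simp: first_layer_def vec_of_list_index mat_of_rows_list_def simp del: vec_of_list_Cons)
  with i show "relu ?v $ i = ?r $ i"
    by (auto dest!: less_5_cases
        simp: relu_def apply_affine_def unit_state_nth unit_state_nth(2)[simplified] unit_sum_def)
qed

lemma relu_step_layer:
  "relu (apply_affine (step_layer (c n) (p (Suc n)) (q (Suc n))) (unit_state p q c n x)) =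
   unit_state p q c (Suc n) x" (is "relu ?v = ?r")
proof (rule eq_vecI)
  show "dim_vec (relu ?v) = dim_vec ?r" by (simp add: relu_def apply_affine_def)
  \<comment> \<open>From here on \<open>?r\<close> is the pending unit and no longer the right-hand
    side of the claim.\<close>
  let ?s = "unit_sum p q c n x" and ?r = "max (p n * x + q n) 0"
  fix i assume "i < dim_vec (unit_state p q c (Suc n) x)"
  then have i: "i < 5" by simp
  \<comment> \<open>The entries before the activation, arranged so that
    \<open>max_minus_max_uminus\<close> turns the differences of positive and negative parts back
    into \<open>?s\<close> and \<open>x\<close>.\<close>
  then have "?v $ i = [max x 0, max (- x) 0,
      (max ?s 0 - max (- ?s) 0) + c n * ?r, - (max ?s 0 - max (- ?s) 0) - c n * ?r,
      p (Suc n) * (max x 0 - max (- x) 0) + q (Suc n)] ! i"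
    by (auto dest!: less_5_cases
        simp: apply_affine_nth sum_lessThan_5 unit_state_nth unit_state_nth(2)[simplified])
       (auto simp: step_layer_def vec_of_list_index mat_of_rows_list_def algebra_simps
         simp del: vec_of_list_Cons)
  with i show "relu ?v $ i = unit_state p q c (Suc n) x $ i"
    unfolding max_minus_max_uminus
    by (auto dest!: less_5_cases simp: relu_def apply_affine_def unit_state_nth
        unit_state_nth(2)[simplified] unit_sum_Suc)
qed

lemma net_fun_unit_net: "net_fun (unit_net p q c n) x = unit_sum p q c (Suc n) x"
proof -
  have "fold (\<lambda>L v. relu (apply_affine L v)) (fst (unit_net p q c n)) (vec 1 (\<lambda>_. x)) =
      unit_state p q c n x"
  proof (induction n)
    case 0
    then show ?case by (simp add: unit_net_def relu_first_layer del: One_nat_def)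
  next
    case (Suc n)
    then show ?case by (simp add: unit_net_def relu_step_layer)
  qed
  moreover have "apply_affine (output_layer (c n)) (unit_state p q c n x) $ 0 =
      max (unit_sum p q c n x) 0 - max (- unit_sum p q c n x) 0 + c n * max (p n * x + q n) 0"
    by (simp add: apply_affine_nth sum_lessThan_5 unit_state_nth)
       (simp add: output_layer_def vec_of_list_index mat_of_rows_list_def del: vec_of_list_Cons)
  ultimately show ?thesis
    by (simp add: net_fun_def unit_sum_Suc max_minus_max_uminus del: One_nat_def)
       (simp add: unit_net_def)
qed

lemma composable_constant_dim:
  assumes "\<And>L. L \<in> set Ls \<Longrightarrow> dim_row (fst L) = d \<and> dim_col (fst L) = d \<and> dim_vec (snd L) = d"
  shows "composable d (Ls @ Ms) d' \<longleftrightarrow> composable d Ms d'"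
  using assms
proof (induction Ls)
  case (Cons L Ls)
  then have "dim_row (fst L) = d" "dim_col (fst L) = d" "dim_vec (snd L) = d" by auto
  with Cons show ?case by (cases L) simp
qed simp

lemma composable_Cons:
  "composable d (L # Ls) d' \<longleftrightarrow>
     dim_col (fst L) = d \<and> dim_vec (snd L) = dim_row (fst L) \<and> composable (dim_row (fst L)) Ls d'"
  by (cases L) simp

lemma scalar_net_unit_net: "scalar_net (unit_net p q c n)"
proof -
  have "composable 5 (map (\<lambda>i. step_layer (c i) (p (Suc i)) (q (Suc i))) [0..<n] @ [output_layer (c n)]) 1"
    by (subst composable_constant_dim) (auto simp: composable_Cons simp del: split_paired_All)
  then show ?thesis by (simp add: scalar_net_def net_layers_def unit_net_def composable_Cons)
qed

lemma net_width_unit_net: "net_width (unit_net p q c n) \<le> 5"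
  by (auto simp: net_width_def unit_net_def)

lemma net_depth_unit_net: "net_depth (unit_net p q c n) = Suc n"
  by (simp add: net_depth_def unit_net_def)

text \<open>The first layer has 5 + 5 entries, each step layer 25 + 5, and the output layer 5 +
  1.\<close>

lemma net_params_unit_net: "net_params (unit_net p q c n) = 30 * n + 16"
  by (simp add: net_params_def net_layers_def unit_net_def case_prod_unfold o_def sum_list_triv)

lemma rational_net_unit_net:
  assumes "\<And>i. i \<le> n \<Longrightarrow> p i \<in> \<rat> \<and> q i \<in> \<rat> \<and> c i \<in> \<rat>"
  shows "rational_net (unit_net p q c n)"
proof -
  let ?rat = "\<lambda>L. elements_mat (fst L) \<subseteq> \<rat> \<and> (\<forall>i<dim_vec (snd L). snd L $ i \<in> \<rat>)"
  have mat: "elements_mat (mat_of_rows_list d rs) \<subseteq> \<rat>"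
    if "\<forall>r\<in>set rs. length r = d \<and> set r \<subseteq> \<rat>" for d and rs :: "real list list"
  proof
    fix e assume "e \<in> elements_mat (mat_of_rows_list d rs)"
    then obtain i j where "i < length rs" "j < d" "e = rs ! i ! j"
      by (auto dest!: elements_matD simp: mat_of_rows_list_def)
    then show "e \<in> \<rat>" using that by (metis nth_mem subsetD)
  qed
  have vec: "\<forall>i<dim_vec (vec_of_list v). vec_of_list v $ i \<in> \<rat>" if "set v \<subseteq> \<rat>" for v :: "real list"
    using that by (auto simp: vec_of_list_index)
  have first: "?rat (first_layer s t)" if "s \<in> \<rat>" "t \<in> \<rat>" for s t
    unfolding first_layer_def fst_conv snd_conv by (intro conjI mat vec) (use that in auto)
  have step: "?rat (step_layer r s t)" if "r \<in> \<rat>" "s \<in> \<rat>" "t \<in> \<rat>" for r s t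
    unfolding step_layer_def fst_conv snd_conv by (intro conjI mat vec) (use that in auto)
  have out: "?rat (output_layer s)" if "s \<in> \<rat>" for s
    unfolding output_layer_def fst_conv snd_conv by (intro conjI mat vec) (use that in auto)
  have "?rat L" if "L \<in> set (net_layers (unit_net p q c n))" for L
  proof -
    consider "L = first_layer (p 0) (q 0)"
      | i where "i < n" "L = step_layer (c i) (p (Suc i)) (q (Suc i))" | "L = output_layer (c n)"
      using \<open>L \<in> _\<close> by (auto simp: net_layers_def unit_net_def)
    then show ?thesis
    proof cases
      case 1
      then show ?thesis using first assms[of 0] by blast
    next
      case (2 i)
      then show ?thesis using step assms[of i] assms[of "Suc i"] by (metis Suc_leI less_imp_le)
    next
      case 3
      then show ?thesis using out assms[of n] by blast
    qed
  qed
  then show ?thesis unfolding rational_net_def by fastforce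
qed

text \<open>Hiding the parameters leaves a predicate that is additive in the number of units, so
  only that number has to be tracked until a network is built.\<close>

definition rational_unit_sum :: "nat \<Rightarrow> (real \<Rightarrow> real) \<Rightarrow> bool" where
  "rational_unit_sum n f \<longleftrightarrow>
     (\<exists>p q c. (\<forall>i<n. p i \<in> \<rat> \<and> q i \<in> \<rat> \<and> c i \<in> \<rat>) \<and> (\<forall>x. f x = unit_sum p q c n x))"

lemma rational_unit_sum_zero: "rational_unit_sum 0 (\<lambda>x. 0)"
  by (simp add: rational_unit_sum_def unit_sum_def)

lemma rational_unit_sum_unit:
  assumes "p \<in> \<rat>" "q \<in> \<rat>" "c \<in> \<rat>"
  shows "rational_unit_sum 1 (\<lambda>x. c * max (p * x + q) 0)"
  unfolding rational_unit_sum_def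
  by (rule exI[of _ "\<lambda>_. p"], rule exI[of _ "\<lambda>_. q"], rule exI[of _ "\<lambda>_. c"])
     (use assms in \<open>simp add: unit_sum_def\<close>)

lemma rational_unit_sum_add:
  assumes "rational_unit_sum n f" "rational_unit_sum m g"
  shows "rational_unit_sum (n + m) (\<lambda>x. f x + g x)"
proof -
  obtain p q c where f: "\<And>i. i < n \<Longrightarrow> p i \<in> \<rat> \<and> q i \<in> \<rat> \<and> c i \<in> \<rat>" "\<And>x. f x = unit_sum p q c n x"
    using assms(1) unfolding rational_unit_sum_def by blast
  obtain p' q' c' where g: "\<And>i. i < m \<Longrightarrow> p' i \<in> \<rat> \<and> q' i \<in> \<rat> \<and> c' i \<in> \<rat>" "\<And>x. g x = unit_sum p' q' c' m x"
    using assms(2) unfolding rational_unit_sum_def by blast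
  define app :: "(nat \<Rightarrow> real) \<Rightarrow> (nat \<Rightarrow> real) \<Rightarrow> nat \<Rightarrow> real"
    where "app u v i = (if i < n then u i else v (i - n))" for u v i
  have "unit_sum (app p p') (app q q') (app c c') (n + l) x = unit_sum p q c n x + unit_sum p' q' c' l x"
    for l x
    by (induction l) (simp_all add: unit_sum_def app_def)
  then show ?thesis
    unfolding rational_unit_sum_def
    by (intro exI[of _ "app p p'"] exI[of _ "app q q'"] exI[of _ "app c c'"]) (auto simp: app_def f g)
qed

lemma rational_unit_sum_net:
  assumes "rational_unit_sum (Suc n) f"
  obtains N where "scalar_net N" "rational_net N" "\<And>x. net_fun N x = f x" "net_width N \<le> 5"
    "net_depth N = Suc n" "net_params N = 30 * n + 16"
proof -
  obtain p q c where f: "\<And>i. i < Suc n \<Longrightarrow> p i \<in> \<rat> \<and> q i \<in> \<rat> \<and> c i \<in> \<rat>"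
    "\<And>x. f x = unit_sum p q c (Suc n) x"
    using assms unfolding rational_unit_sum_def by blast
  show thesis
    by (rule that[of "unit_net p q c n"])
       (use f in \<open>simp_all add: scalar_net_unit_net rational_net_unit_net net_fun_unit_net
          net_width_unit_net net_depth_unit_net net_params_unit_net less_Suc_eq_le\<close>)
qed

section \<open>Evaluation of bump series\<close>

lemma hat_nonneg: "0 \<le> hat x" and hat_le_1: "hat x \<le> 1"
  by (auto simp: hat_def)

lemma hat_nonzero_iff: "hat x \<noteq> 0 \<longleftrightarrow> 0 < x \<and> x < 2"
  by (auto simp: hat_def max_def abs_if)

text \<open>The \<open>k\<close>-th bump lives on \<open>2 < 2 ^ k * x < 4\<close>. Each further
  level at least doubles the scaled argument and pushes it beyond the support of the later
  bump.\<close>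

lemma hat_scaled_less:
  assumes "hat (2 ^ k * x - 2) \<noteq> 0" "k < l"
  shows "4 < 2 ^ l * x"
proof -
  have x: "2 < 2 ^ k * x" using assms(1) by (simp add: hat_nonzero_iff)
  then have "0 < x" by (smt (verit) mult_nonneg_nonpos zero_le_power)
  moreover have "(2::real) ^ Suc k \<le> 2 ^ l" using assms(2) by (intro power_increasing) auto
  ultimately have "2 ^ Suc k * x \<le> 2 ^ l * x" by simp
  with x show ?thesis by simp
qed

lemma hat_scaled_unique:
  assumes "hat (2 ^ k * x - 2) \<noteq> 0" "hat (2 ^ l * x - 2) \<noteq> 0"
  shows "k = l"
  using assms hat_scaled_less[of k x l] hat_scaled_less[of l x k]
  by (cases k l rule: linorder_cases) (auto simp: hat_nonzero_iff)

lemma bump_series_eq: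
  assumes "1 \<le> k" "hat (2 ^ k * x - 2) \<noteq> 0"
  shows "bump_series a t x = weight a k * t k * hat (2 ^ k * x - 2)"
proof -
  have "hat (2 ^ Suc i * x - 2) = 0" if "i \<notin> {k - 1}" for i
    using hat_scaled_unique[OF assms(2), of "Suc i"] that by force
  then have "bump_series a t x =
      (\<Sum>i\<in>{k - 1}. weight a (Suc i) * t (Suc i) * hat (2 ^ Suc i * x - 2))"
    unfolding bump_series_def by (intro suminf_finite) auto
  then show ?thesis using assms(1) by simp
qed

lemma bump_series_eq_0:
  assumes "\<And>k. 1 \<le> k \<Longrightarrow> hat (2 ^ k * x - 2) = 0"
  shows "bump_series a t x = 0"
  using assms unfolding bump_series_def by (simp del: power_Suc)

text \<open>The point \<open>3 / 2 ^ k\<close> is the midpoint of the support of the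
  \<open>k\<close>-th bump, where the hat has value 1.\<close>

lemma bump_series_peak:
  assumes "1 \<le> k"
  shows "bump_series a t (3 / 2 ^ k) = weight a k * t k"
  using bump_series_eq[OF assms, of "3 / 2 ^ k"] by (simp add: hat_def)

text \<open>The hat with everything left of its peak replaced by the constant 1, so that it also
  dominates all later bumps.\<close>

definition ramp :: "real \<Rightarrow> real" where
  "ramp y = max (2 - y) 0 - max (1 - y) 0"

lemma ramp_bounds: "0 \<le> ramp y" "ramp y \<le> 1"
  and ramp_eq_1: "y \<le> 1 \<Longrightarrow> ramp y = 1" and ramp_eq_0: "2 \<le> y \<Longrightarrow> ramp y = 0"
  and hat_le_ramp: "hat y \<le> ramp y"
  by (auto simp: ramp_def hat_def max_def abs_if)

text \<open>The hat has kinks at 0, 1 and 2 with slope changes 1, -2 and 1; the shift by 2 moves the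
  offsets to -2, -3 and -4.\<close>

lemma rational_unit_sum_hat:
  assumes "p \<in> \<rat>" "c \<in> \<rat>"
  shows "rational_unit_sum 3 (\<lambda>x. c * hat (p * x - 2))"
proof -
  have "rational_unit_sum (1 + 1 + 1) (\<lambda>x. c * max (p * x + - 2) 0 + (- 2 * c) * max (p * x + - 3) 0
      + c * max (p * x + - 4) 0)"
    using assms by (intro rational_unit_sum_add rational_unit_sum_unit Rats_minus_iff[THEN iffD2] Rats_mult) auto
  moreover have "c * max (p * x + - 2) 0 + (- 2 * c) * max (p * x + - 3) 0 + c * max (p * x + - 4) 0 =
      c * hat (p * x - 2)" for x
  proof -
    have hat: "hat (p * x - 2) = max (p * x + - 2) 0 - 2 * max (p * x + - 3) 0 + max (p * x + - 4) 0"
      by (auto simp: hat_def max_def abs_if)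
    show ?thesis unfolding hat by (simp add: algebra_simps)
  qed
  ultimately show ?thesis by (simp add: numeral_3_eq_3)
qed

lemma rational_unit_sum_ramp:
  assumes "p \<in> \<rat>" "c \<in> \<rat>"
  shows "rational_unit_sum 2 (\<lambda>x. c * ramp (p * x - 2))"
proof -
  have "rational_unit_sum (1 + 1) (\<lambda>x. c * max (- p * x + 4) 0 + (- c) * max (- p * x + 3) 0)"
    using assms by (intro rational_unit_sum_add rational_unit_sum_unit) auto
  moreover have "c * max (- p * x + 4) 0 + (- c) * max (- p * x + 3) 0 = c * ramp (p * x - 2)" for x
    by (auto simp: ramp_def algebra_simps)
  ultimately show ?thesis by (simp add: numeral_2_eq_2)
qed

lemma sum_affine_levels:
  "(\<Sum>i<m. Y - real i * l) = real m * Y - l * (real m * (real m - 1) / 2)"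
  by (induction m) (auto simp: field_simps)

section \<open>Radices, number of levels and number of codewords\<close>

locale bump_quantizer =
  fixes a \<epsilon> :: real
  assumes a_pos: "0 < a" and a_less_1: "a < 1" and eps_pos: "0 < \<epsilon>"
begin

abbreviation n where "n \<equiv> radix a \<epsilon>"

text \<open>Since the weights decrease, this is the number of bumps of height above 2 \<epsilon>,
  and thus the last index whose radix exceeds 1.\<close>

definition levels :: nat where "levels = (LEAST i. weight a (Suc i) \<le> 2 * \<epsilon>)"

lemma weight_pos: "0 < weight a k"
  using a_pos by (simp add: weight_def)

lemma weight_antimono: "k \<le> l \<Longrightarrow> weight a l \<le> weight a k"
  using a_pos a_less_1 by (simp add: weight_def power_decreasing)

lemma weight_le_iff: "weight a (Suc i) \<le> 2 * \<epsilon> \<longleftrightarrow> levels \<le> i"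
proof
  have "\<exists>i. weight a (Suc i) \<le> 2 * \<epsilon>"
    using real_arch_pow_inv[of "2 * \<epsilon>" a] eps_pos a_less_1 by (auto simp: weight_def intro: less_imp_le)
  then have "weight a (Suc levels) \<le> 2 * \<epsilon>" unfolding levels_def by (rule LeastI_ex)
  then show "weight a (Suc i) \<le> 2 * \<epsilon>" if "levels \<le> i" for i
    using that weight_antimono[of "Suc levels" "Suc i"] by simp
  show "levels \<le> i" if "weight a (Suc i) \<le> 2 * \<epsilon>" unfolding levels_def using that by (rule Least_le)
qed

text \<open>The two sides of the ceiling: the upper bound on the radix serves the packing and the
  rounding error of the entropy, the lower bound serves the covering.\<close>

lemma radix_props:
  shows "0 < n k" "real (n k) < weight a k / (2 * \<epsilon>) + 1" "weight a k \<le> 2 * \<epsilon> * real (n k)"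
proof -
  have pos: "0 < weight a k / (2 * \<epsilon>)" using weight_pos eps_pos by simp
  then show "0 < n k" by (simp add: radix_def)
  have n: "real (n k) = of_int \<lceil>weight a k / (2 * \<epsilon>)\<rceil>" using pos by (simp add: radix_def)
  then show "real (n k) < weight a k / (2 * \<epsilon>) + 1" by linarith
  have "weight a k / (2 * \<epsilon>) \<le> real (n k)" unfolding n by linarith
  then show "weight a k \<le> 2 * \<epsilon> * real (n k)" using eps_pos by (simp add: field_simps)
qed

sublocale finite_radices n levels
proof
  fix k :: nat assume k: "1 \<le> k"
  show "0 < n k" by (rule radix_props)
  have "1 < n k \<longleftrightarrow> 1 < weight a k / (2 * \<epsilon>)" unfolding radix_def by linarith
  also have "\<dots> \<longleftrightarrow> \<not> weight a (Suc (k - 1)) \<le> 2 * \<epsilon>" using eps_pos k by (auto simp: field_simps)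
  also have "\<dots> \<longleftrightarrow> k \<le> levels" unfolding weight_le_iff using k by auto
  finally show "1 < n k \<longleftrightarrow> k \<le> levels" .
qed

definition codewords :: nat where "codewords = (\<Prod>k=1..levels. n k)"

lemma codewords_pos: "0 < codewords"
  unfolding codewords_def by (simp add: radix_props)

lemma prodinf_radix: "(\<Prod>k. n (Suc k)) = codewords"
proof -
  have "(\<lambda>k. n (Suc k)) has_prod (\<Prod>k<levels. n (Suc k))"
    by (intro has_prod_finite) (auto simp: radix_eq_1)
  then show ?thesis
    using has_prod_unique prod.atLeast1_atMost_eq[of n levels] by (fastforce simp: codewords_def)
qed

lemma log_codewords: "log 2 (real codewords) = (\<Sum>k<levels. log 2 (real (n (Suc k))))"
proof -
  have "ln (real codewords) = (\<Sum>k<levels. ln (real (n (Suc k))))"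
    unfolding codewords_def of_nat_prod by (subst ln_prod) (simp_all add: radix_props sum.atLeast1_atMost_eq)
  then show ?thesis by (simp add: log_def sum_divide_distrib)
qed

lemma suminf_log_radix: "(\<Sum>k. log 2 (real (n (Suc k)))) = log 2 (real codewords)"
  unfolding log_codewords by (intro suminf_finite) (auto simp: radix_eq_1)

section \<open>Packing and covering the bump class\<close>

text \<open>Digits select equidistant heights from 0 to \<open>weight a k\<close>. Their spacing
  exceeds 2 \<epsilon> because \<open>n k - 1\<close> is less than
  \<open>weight a k / (2 * \<epsilon>)\<close>, and the peak of a level where two tuples differ
  shows this gap.\<close>

lemma packing_bound: "enat codewords \<le> covering_number \<epsilon> (bump_class a)"
proof -
  \<comment> \<open>For \<open>n k = 1\<close> the division by zero yields the coefficient \<open>0\<close>.\<close>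
  define g where "g j = bump_series a (\<lambda>k. real (j k) / real (n k - 1))" for j
  have g_class: "g j \<in> bump_class a" if "j \<in> digit_tuples n" for j
  proof -
    have "real (j k) / real (n k - 1) \<in> {0..1}" if "1 \<le> k" for k
      using digit_tupleD(1)[OF \<open>j \<in> _\<close> that] by (auto simp: divide_le_eq_1)
    then show ?thesis by (auto simp: g_def bump_class_def)
  qed
  have sep: "\<exists>x. \<bar>g i x - g j x\<bar> > 2 * \<epsilon>"
    if ij: "i \<in> digit_tuples n" "j \<in> digit_tuples n" "i \<noteq> j" for i j
  proof -
    obtain k where k: "k \<in> {1..levels}" "i k \<noteq> j k" using digit_tuples_eqI ij by blast
    then have n: "1 < n k" using radix_gt_1_iff by auto
    have "2 * \<epsilon> * real (n k - 1) < weight a k"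
      using radix_props(2)[of k] n eps_pos by (simp add: field_simps of_nat_diff)
    also have "\<dots> \<le> weight a k * \<bar>real (i k) - real (j k)\<bar>" using k(2) weight_pos[of k] by simp
    finally have "2 * \<epsilon> < weight a k * \<bar>real (i k) - real (j k)\<bar> / real (n k - 1)"
      using n by (simp add: less_divide_eq)
    also have "\<dots> = \<bar>g i (3 / 2 ^ k) - g j (3 / 2 ^ k)\<bar>"
      using k(1) weight_pos[of k] n
      by (simp add: g_def bump_series_peak abs_mult flip: right_diff_distrib diff_divide_distrib)
    finally show ?thesis by blast
  qed
  have "inj_on g (digit_tuples n)"
  proof (intro inj_onI, rule ccontr)
    fix i j assume "i \<in> digit_tuples n" "j \<in> digit_tuples n" "g i = g j" "i \<noteq> j"
    then show False using sep[of i j] eps_pos by simp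
  qed
  then have "card (g ` digit_tuples n) = codewords" by (simp add: card_image card_digit_tuples codewords_def)
  moreover have "enat (card (g ` digit_tuples n)) \<le> covering_number \<epsilon> (bump_class a)"
    using g_class sep eps_pos finite_digit_tuples
    by (intro covering_number_ge_packing) auto
  ultimately show ?thesis by simp
qed

text \<open>The levels of radix \<open>1\<close> cannot be reconstructed by their infinitely many midpoints; a constant
  that ramps down along the right flank of the bump at level \<open>levels + 1\<close> serves all of them.\<close>

definition reconstruct :: "(nat \<Rightarrow> nat) \<Rightarrow> real \<Rightarrow> real" where
  "reconstruct j x =
     (\<Sum>k=1..levels. weight a k * (2 * real (j k) + 1) / (2 * real (n k)) * hat (2 ^ k * x - 2)) +
     weight a (Suc levels) / 2 * ramp (2 ^ Suc levels * x - 2)"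

text \<open>The coefficient is read off at the peak. The minimum handles coefficient 1, where the
  floor would give the illegal digit \<open>n k\<close>; together with \<open>nat\<close> it makes
  the digits legal for every \<open>f\<close>.\<close>

definition quantize :: "(real \<Rightarrow> real) \<Rightarrow> nat \<Rightarrow> nat" where
  "quantize f = (\<lambda>k\<in>{1..}. min (nat \<lfloor>f (3 / 2 ^ k) / weight a k * n k\<rfloor>) (n k - 1))"

lemma quantize_digit_tuples: "quantize f \<in> digit_tuples n"
proof -
  have "min i (n k - 1) < n k" for i k using radix_props(1)[of k] by linarith
  then show ?thesis unfolding quantize_def digit_tuples_def by (intro restrict_PiE_iff[THEN iffD2]) blast
qed

text \<open>The coefficient lies in the closed cell from \<open>?j / n k\<close> to
  \<open>(?j + 1) / n k\<close>, and the reconstruction uses its midpoint.\<close>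

lemma quantize_error:
  assumes "t k \<in> {0..1}" "1 \<le> k"
  shows "\<bar>t k - (2 * real (quantize (bump_series a t) k) + 1) / (2 * real (n k))\<bar> \<le> 1 / (2 * real (n k))"
proof -
  let ?j = "quantize (bump_series a t) k"
  have "?j = min (nat \<lfloor>t k * n k\<rfloor>) (n k - 1)"
    using assms(2) weight_pos[of k] by (simp add: quantize_def bump_series_peak)
  moreover have "0 \<le> t k * n k" "t k * n k \<le> n k" using assms(1) by (auto simp: mult_left_le_one_le)
  ultimately have "real ?j \<le> t k * n k" "t k * n k \<le> real ?j + 1"
    using radix_props(1)[of k] by (auto simp: min_def) linarith+
  then have "\<bar>2 * (t k * n k) - (2 * real ?j + 1)\<bar> \<le> 1" by linarith
  then have "\<bar>2 * (t k * n k) - (2 * real ?j + 1)\<bar> / (2 * real (n k)) \<le> 1 / (2 * real (n k))"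
    by (intro divide_right_mono) auto
  moreover have "\<bar>2 * (t k * n k) - (2 * real ?j + 1)\<bar> / (2 * real (n k)) =
      \<bar>t k - (2 * real ?j + 1) / (2 * real (n k))\<bar>"
    using radix_props(1)[of k] by (simp add: abs_div_pos diff_divide_distrib)
  ultimately show ?thesis by simp
qed

text \<open>The right end of the bump at level \<open>levels + 1\<close>, where
  \<open>?y = 2\<close>, splits the line. To its left all quantized bumps vanish and only the ramp
  acts; to its right the ramp vanishes and at most one quantized bump is active.\<close>

lemma reconstruct_error:
  assumes t: "\<And>k. 1 \<le> k \<Longrightarrow> t k \<in> {0..1}"
  shows "\<bar>bump_series a t x - reconstruct (quantize (bump_series a t)) x\<bar> \<le> \<epsilon>"
proof -
  let ?f = "bump_series a t x" and ?j = "quantize (bump_series a t)"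
  let ?c = "\<lambda>k. weight a k * (2 * real (?j k) + 1) / (2 * real (n k))"
  let ?y = "2 ^ Suc levels * x - 2" and ?w = "weight a (Suc levels)"
  have w: "0 < ?w" "?w \<le> 2 * \<epsilon>" using weight_pos weight_le_iff by auto
  consider (tail) "?y \<le> 2" | (active) k where "2 < ?y" "1 \<le> k" "hat (2 ^ k * x - 2) \<noteq> 0"
    | (gap) "2 < ?y" "\<And>k. 1 \<le> k \<Longrightarrow> hat (2 ^ k * x - 2) = 0"
    by force
  then show ?thesis
  proof cases
    case tail
    have "hat (2 ^ k * x - 2) = 0" if "k \<in> {1..levels}" for k
      using hat_scaled_less[of k x "Suc levels"] tail that by auto
    then have r: "reconstruct ?j x = ?w / 2 * ramp ?y" by (simp add: reconstruct_def del: power_Suc)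
    \<comment> \<open>The reconstruction is the midpoint of this range, whose length is at most 2
      \<epsilon>.\<close>
    have f: "0 \<le> ?f \<and> ?f \<le> ?w * ramp ?y"
    proof (cases "\<exists>k\<ge>1. hat (2 ^ k * x - 2) \<noteq> 0")
      case True
      then obtain k where k: "1 \<le> k" "hat (2 ^ k * x - 2) \<noteq> 0" by blast
      have "Suc levels \<le> k" using hat_scaled_less[OF k(2), of "Suc levels"] tail by force
      have "hat (2 ^ k * x - 2) \<le> ramp ?y"
      proof (cases "k = Suc levels")
        case False
        \<comment> \<open>A bump beyond level \<open>levels + 1\<close> is active only where the
          ramp is still constantly 1.\<close>
        with \<open>Suc levels \<le> k\<close> have "(2::real) ^ Suc (Suc levels) \<le> 2 ^ k" by (intro power_increasing) auto
        moreover have "0 < x" using k(2) by (simp add: hat_nonzero_iff) (smt (verit) mult_nonneg_nonpos zero_le_power)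
        ultimately have "2 * (2 ^ Suc levels * x) \<le> 2 ^ k * x" by simp
        then have "?y \<le> 1" using k(2) unfolding hat_nonzero_iff by linarith
        then show ?thesis using ramp_eq_1[of ?y] hat_le_1 by metis
      qed (use hat_le_ramp in simp)
      moreover have "weight a k * t k \<le> ?w * 1"
        using weight_antimono[OF \<open>Suc levels \<le> k\<close>] weight_pos[of k] t[OF k(1)] by (intro mult_mono) auto
      ultimately have "?f \<le> ?w * 1 * ramp ?y"
        unfolding bump_series_eq[OF k] using weight_pos[of "Suc levels"] hat_nonneg
        by (intro mult_mono[of "weight a k * t k"]) auto
      moreover have "0 \<le> ?f"
        unfolding bump_series_eq[OF k] using weight_pos[of k] hat_nonneg t[OF k(1)] by simp
      ultimately show ?thesis by simp
    qed (use bump_series_eq_0 ramp_bounds w in auto)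
    have "?w * ramp ?y \<le> 2 * \<epsilon> * 1" using w ramp_bounds[of ?y] eps_pos by (intro mult_mono) auto
    with f show ?thesis unfolding r by linarith
  next
    case active
    \<comment> \<open>Every bump beyond \<open>levels\<close> has its support in the region
      \<open>?y \<le> 2\<close>.\<close>
    have "k \<le> levels"
    proof (rule ccontr)
      assume "\<not> k \<le> levels"
      then have "(2::real) ^ Suc levels \<le> 2 ^ k" by (intro power_increasing) auto
      moreover have "0 < x" using active(1) by (smt (verit) mult_nonneg_nonpos zero_le_power)
      ultimately have "2 ^ Suc levels * x \<le> 2 ^ k * x" by (intro mult_right_mono) auto
      then show False using active(1,3) unfolding hat_nonzero_iff by linarith
    qed
    have "(\<Sum>i=1..levels. ?c i * hat (2 ^ i * x - 2)) = (\<Sum>i\<in>{k}. ?c i * hat (2 ^ i * x - 2))"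
      using hat_scaled_unique[OF active(3)] \<open>k \<le> levels\<close> active(2) by (intro sum.mono_neutral_right) auto
    then have "reconstruct ?j x = ?c k * hat (2 ^ k * x - 2)"
      using ramp_eq_0[of ?y] active(1) by (simp add: reconstruct_def del: power_Suc)
    then have "\<bar>?f - reconstruct ?j x\<bar> =
        weight a k * \<bar>t k - (2 * real (?j k) + 1) / (2 * real (n k))\<bar> * hat (2 ^ k * x - 2)"
      unfolding bump_series_eq[OF active(2,3)] using weight_pos[of k] hat_nonneg
      by (simp add: abs_mult flip: left_diff_distrib right_diff_distrib times_divide_eq_right)
    also have "\<dots> \<le> weight a k * (1 / (2 * real (n k))) * 1"
      using quantize_error[OF t] active(2) weight_pos[of k] hat_nonneg hat_le_1
      by (intro mult_mono) auto
    also have "\<dots> \<le> \<epsilon>" using radix_props(1,3)[of k] by (simp add: divide_le_eq mult.commute mult.left_commute)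
    finally show ?thesis .
  next
    case gap
    then show ?thesis
      using eps_pos ramp_eq_0[of ?y] by (simp add: bump_series_eq_0 reconstruct_def del: power_Suc)
  qed
qed



lemma bounded_reconstruct: "bounded (range (reconstruct j))"
proof -
  let ?c = "\<lambda>k. weight a k * (2 * real (j k) + 1) / (2 * real (n k))"
  have c: "0 \<le> ?c k" for k using weight_pos[of k] by simp
  have "\<bar>reconstruct j x\<bar> \<le> (\<Sum>k=1..levels. ?c k * 1) + weight a (Suc levels) / 2 * 1" for x
  proof -
    have "(\<Sum>k=1..levels. ?c k * hat (2 ^ k * x - 2)) \<le> (\<Sum>k=1..levels. ?c k * 1)"
      by (intro sum_mono mult_left_mono hat_le_1 c)
    moreover have "0 \<le> (\<Sum>k=1..levels. ?c k * hat (2 ^ k * x - 2))"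
      by (intro sum_nonneg mult_nonneg_nonneg hat_nonneg c)
    moreover have "weight a (Suc levels) / 2 * ramp (2 ^ Suc levels * x - 2) \<le> weight a (Suc levels) / 2 * 1"
      using weight_pos[of "Suc levels"] by (intro mult_left_mono ramp_bounds) auto
    moreover have "0 \<le> weight a (Suc levels) / 2 * ramp (2 ^ Suc levels * x - 2)"
      using weight_pos[of "Suc levels"] by (intro mult_nonneg_nonneg ramp_bounds) auto
    ultimately show ?thesis unfolding reconstruct_def by linarith
  qed
  then show ?thesis by (intro boundedI[where B = "(\<Sum>k=1..levels. ?c k * 1) + weight a (Suc levels) / 2 * 1"]) auto
qed

lemma quantize_distortion:
  assumes "f \<in> bump_class a"
  shows "\<bar>f x - reconstruct (quantize f) x\<bar> \<le> \<epsilon>"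
  using assms reconstruct_error by (auto simp: bump_class_def)

section \<open>Exact covering number, optimal code and its reconstructions\<close>

lemma covering_number_bump_class: "covering_number \<epsilon> (bump_class a) = enat codewords"
proof (rule antisym)
  let ?S = "reconstruct ` digit_tuples n"
  have "bump_class a \<subseteq> (\<Union>g\<in>?S. unif_cball g \<epsilon>)"
    using quantize_distortion quantize_digit_tuples eps_pos
    by (auto simp: mem_unif_cball_iff intro!: bexI[of _ "quantize _"])
  then have "covering_number \<epsilon> (bump_class a) \<le> enat (card ?S)"
    using finite_digit_tuples bounded_reconstruct by (intro covering_number_le) auto
  also have "\<dots> \<le> enat codewords"
    using card_image_le[OF finite_digit_tuples, of reconstruct] by (simp add: card_digit_tuples codewords_def)
  finally show "covering_number \<epsilon> (bump_class a) \<le> enat codewords" .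
qed (rule packing_bound)

text \<open>Ranks are below \<open>codewords\<close>, so they fit into the rounded-up logarithm of
  it; the exact covering number rules out any shorter code.\<close>

lemma optimal_mixed_radix_code:
  obtains E R where
    "mixed_radix_code n (nat \<lceil>log 2 (real codewords)\<rceil>) (bump_class a) quantize reconstruct E R"
    "distortion (bump_class a) E R \<le> ennreal \<epsilon>"
    "min_code_length \<epsilon> (bump_class a) = enat (nat \<lceil>log 2 (real codewords)\<rceil>)"
proof -
  let ?B = "nat \<lceil>log 2 (real codewords)\<rceil>"
  have "(\<Prod>k=1..levels. n k) \<le> 2 ^ ?B"
    using le_two_power_ceiling_log[OF codewords_pos] unfolding codewords_def .
  then obtain E R where code: "mixed_radix_code n ?B (bump_class a) quantize reconstruct E R"
    and ER: "\<And>f. f \<in> bump_class a \<Longrightarrow> R (E f) = reconstruct (quantize f)"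
    using mixed_radix_code_exists[of "bump_class a" quantize reconstruct ?B]
      quantize_digit_tuples bounded_reconstruct by metis
  have dist: "distortion (bump_class a) E R \<le> ennreal \<epsilon>"
    using eps_pos quantize_distortion by (simp add: distortion_le_iff ER)
  have "fixed_length_code ?B (bump_class a) E R" using code by (simp add: mixed_radix_code_def)
  then have "min_code_length \<epsilon> (bump_class a) = enat ?B"
    using eps_pos covering_number_bump_class codewords_pos dist by (intro min_code_length_eqI) auto
  then show thesis using that code dist by blast
qed

text \<open>Three units for each quantized bump and two for the ramp; all coefficients are built
  from \<open>a\<close>, digits, radices and powers of two.\<close>

lemma rational_unit_sum_reconstruct:
  assumes "a \<in> \<rat>"
  shows "rational_unit_sum (3 * levels + 2) (reconstruct j)"
proof -
  have w: "weight a k \<in> \<rat>" for k using assms by (simp add: weight_def)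
  have "rational_unit_sum (3 * l)
      (\<lambda>x. \<Sum>k=1..l. weight a k * (2 * real (j k) + 1) / (2 * real (n k)) * hat (2 ^ k * x - 2))" for l
  proof (induction l)
    case (Suc l)
    have "rational_unit_sum (3 * l + 3) (\<lambda>x.
        (\<Sum>k=1..l. weight a k * (2 * real (j k) + 1) / (2 * real (n k)) * hat (2 ^ k * x - 2)) +
        weight a (Suc l) * (2 * real (j (Suc l)) + 1) / (2 * real (n (Suc l))) * hat (2 ^ Suc l * x - 2))"
      using w by (intro rational_unit_sum_add Suc.IH rational_unit_sum_hat) auto
    then show ?case by (simp add: add.commute)
  qed (simp add: rational_unit_sum_zero)
  then show ?thesis
    using w unfolding reconstruct_def by (intro rational_unit_sum_add rational_unit_sum_ramp) auto
qed

section \<open>Number of levels and metric entropy\<close>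

lemma log_inverse_a_pos: "0 < log 2 (1 / a)"
  using a_pos a_less_1 by simp

lemma log_scaled_weight: "log 2 (a ^ i / (2 * \<epsilon>)) = log 2 (1 / \<epsilon>) - 1 - real i * log 2 (1 / a)"
  using a_pos eps_pos by (simp add: log_divide log_mult log_nat_power)

text \<open>With X and \<lambda> the logarithms of \<open>1 / \<epsilon>\<close> and
  \<open>1 / a\<close>, this makes \<open>levels\<close> the ceiling of (X - 1) / \<lambda> whenever
  that is positive.\<close>

lemma less_levels_iff: "i < levels \<longleftrightarrow> real i * log 2 (1 / a) < log 2 (1 / \<epsilon>) - 1"
proof -
  have "i < levels \<longleftrightarrow> 1 < a ^ i / (2 * \<epsilon>)"
    using weight_le_iff[of i] eps_pos by (auto simp: weight_def field_simps)
  also have "\<dots> \<longleftrightarrow> 0 < log 2 (a ^ i / (2 * \<epsilon>))" using a_pos eps_pos by (subst zero_less_log_cancel_iff) auto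
  finally show ?thesis by (simp add: log_scaled_weight)
qed

lemma levels_le: "real levels \<le> 1 + log_plus (1 / \<epsilon>) / log 2 (1 / a)"
proof (cases levels)
  case (Suc i)
  then have "real i * log 2 (1 / a) \<le> log_plus (1 / \<epsilon>)"
    using less_levels_iff[of i] by (simp add: log_plus_def)
  then show ?thesis using log_inverse_a_pos Suc by (simp add: pos_le_divide_eq)
qed (use log_inverse_a_pos in \<open>simp add: log_plus_def\<close>)

text \<open>A sum of \<open>3 * levels + 2\<close> units costs \<open>90 * levels + 46\<close>
  parameters, which also bounds the depth. Inserting \<open>levels_le\<close> gives the constant 136
  = 90 + 46 and the coefficient 90 / \<lambda> of the logarithm, where \<lambda> is
  \<open>log 2 (1 / a)\<close>.\<close>

lemma reconstruct_net:
  assumes "a \<in> \<rat>"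
  defines "K \<equiv> 136 + 90 / log 2 (1 / a)"
  obtains N where "scalar_net N" "rational_net N" "\<And>x. net_fun N x = reconstruct j x" "net_width N \<le> 5"
    "real (net_depth N) \<le> K * (1 + log_plus (1 / \<epsilon>))"
    "real (net_params N) \<le> K * (1 + log_plus (1 / \<epsilon>))"
proof -
  have "rational_unit_sum (Suc (3 * levels + 1)) (reconstruct j)"
    using rational_unit_sum_reconstruct[OF assms(1)] by simp
  then obtain N where N: "scalar_net N" "rational_net N" "\<And>x. net_fun N x = reconstruct j x"
      "net_width N \<le> 5" "net_depth N = Suc (3 * levels + 1)" "net_params N = 30 * (3 * levels + 1) + 16"
    by (rule rational_unit_sum_net) blast
  have L: "0 \<le> log_plus (1 / \<epsilon>)" by (simp add: log_plus_def)
  have "90 * real levels + 46 \<le> 90 * (1 + log_plus (1 / \<epsilon>) / log 2 (1 / a)) + 46" using levels_le by simp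
  also have "\<dots> = 136 + 90 / log 2 (1 / a) * log_plus (1 / \<epsilon>)" by simp
  also have "\<dots> \<le> K * (1 + log_plus (1 / \<epsilon>))"
  proof -
    have "K * (1 + log_plus (1 / \<epsilon>)) =
        136 + 90 / log 2 (1 / a) * log_plus (1 / \<epsilon>) + (90 / log 2 (1 / a) + 136 * log_plus (1 / \<epsilon>))"
      by (simp add: K_def distrib_right distrib_left)
    moreover have "0 \<le> 90 / log 2 (1 / a) + 136 * log_plus (1 / \<epsilon>)" using L log_inverse_a_pos by simp
    ultimately show ?thesis by linarith
  qed
  finally have "90 * real levels + 46 \<le> K * (1 + log_plus (1 / \<epsilon>))" .
  then show thesis using N by (intro that[of N]) auto
qed

lemma metric_entropy_eq: "metric_entropy \<epsilon> (bump_class a) = (\<Sum>i<levels. log 2 (real (n (Suc i))))"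
  by (simp add: metric_entropy_def covering_number_bump_class log_codewords)

text \<open>The main term \<open>\<Sum>i<levels. X - 1 - i \<lambda>\<close> is quadratic in \<open>levels\<close>, and \<open>levels\<close> is within distance
  \<open>1/2\<close> of its maximizer \<open>(X - 1) / \<lambda> + 1/2\<close>. The rounding errors are dominated by a geometric series
  when summed from the last level down.\<close>

lemma metric_entropy_bounds:
  defines "X \<equiv> log 2 (1 / \<epsilon>)" and "l \<equiv> log 2 (1 / a)"
  defines "G \<equiv> metric_entropy \<epsilon> (bump_class a) - (X - 1)\<^sup>2 / (2 * l) - (X - 1) / 2"
  assumes X: "1 < X"
  shows "0 \<le> G" "G \<le> l / 8 + 1 / ((1 - a) * ln 2)"
proof -
  let ?H = "metric_entropy \<epsilon> (bump_class a)"
  define S where "S = (\<Sum>i<levels. X - 1 - real i * l)"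
  define z where "z i = a ^ i / (2 * \<epsilon>)" for i
  have l: "0 < l" using log_inverse_a_pos by (simp add: l_def)
  have z: "0 < z i" "log 2 (z i) = X - 1 - real i * l" for i
    using a_pos eps_pos log_scaled_weight by (auto simp: z_def X_def l_def)
  have nz: "z i \<le> real (n (Suc i))" "real (n (Suc i)) \<le> z i + 1" for i
    using radix_props(2,3)[of "Suc i"] eps_pos by (auto simp: z_def weight_def field_simps)

  define r where "r = (X - 1) / l"
  \<comment> \<open>The rounding excess in \<open>levels\<close>, which is the ceiling of
    \<open>r\<close>; the quadratic main term is largest at \<open>u = 1 / 2\<close>.\<close>
  define u where "u = real levels - r"
  have "0 < levels" using less_levels_iff[of 0] X by (simp add: X_def)
  then have "real (levels - 1) * l < X - 1" using less_levels_iff[of "levels - 1"] by (simp add: X_def l_def)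
  moreover have "X - 1 \<le> real levels * l" using less_levels_iff[of levels] by (simp add: X_def l_def)
  ultimately have u: "0 \<le> u" "u \<le> 1"
    using l \<open>0 < levels\<close> by (auto simp: u_def r_def of_nat_diff field_simps)
  have Y: "X - 1 = l * r" using l by (simp add: r_def)
  \<comment> \<open>Substituting \<open>levels = r + u\<close> into the quadratic leaves exactly the
    two subtracted terms and a remainder in \<open>u\<close> alone.\<close>
  have S: "S - (X - 1)\<^sup>2 / (2 * l) - (X - 1) / 2 = l / 2 * (u * (1 - u))"
    unfolding S_def sum_affine_levels Y u_def using l by (simp add: field_simps power2_eq_square)

  have "S \<le> ?H"
    unfolding metric_entropy_eq S_def z(2)[symmetric]
    by (intro sum_mono log_le_cancel_iff[THEN iffD2] nz z) (simp_all add: radix_props(1))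
  moreover have "0 \<le> l / 2 * (u * (1 - u))" using u l by simp
  ultimately show "0 \<le> G" using S unfolding G_def by linarith

  \<comment> \<open>Rounding up costs at most \<open>log 2 (1 + 1 / z i)\<close>. The last quantized
    weight \<open>a ^ (levels - 1)\<close> is still above 2 \<epsilon>, which bounds
    \<open>1 / z i\<close> by a power of \<open>a\<close> that counts levels from the last
    one.\<close>
  have "log 2 (real (n (Suc i))) \<le> (X - 1 - real i * l) + a ^ (levels - Suc i) / ln 2" if "i < levels" for i
  proof -
    have "log 2 (real (n (Suc i))) \<le> log 2 (z i * (1 + 1 / z i))"
      using nz(2)[of i] z(1)[of i] radix_props(1)[of "Suc i"] by (simp add: algebra_simps)
    also have "\<dots> = log 2 (z i) + ln (1 + 1 / z i) / ln 2"
      using z(1)[of i] add_pos_pos[of 1 "1 / z i"] by (subst log_mult) (auto simp: log_def)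
    also have "ln (1 + 1 / z i) \<le> 1 / z i" using z(1)[of i] by (intro ln_add_one_self_le_self) simp
    also have "1 / z i \<le> a ^ (levels - Suc i)"
    proof -
      have "2 * \<epsilon> \<le> a ^ (levels - 1)"
        using weight_le_iff[of "levels - 1"] \<open>0 < levels\<close> by (auto simp: weight_def)
      also have "\<dots> = a ^ (levels - Suc i) * a ^ i" using that by (simp flip: power_add)
      finally show ?thesis using a_pos by (simp add: z_def pos_divide_le_eq)
    qed
    finally show ?thesis by (simp add: z(2) divide_right_mono)
  qed
  then have "?H \<le> S + (\<Sum>i<levels. a ^ (levels - Suc i)) / ln 2"
    unfolding metric_entropy_eq S_def sum_divide_distrib sum.distrib[symmetric] by (intro sum_mono) simp
  also have "(\<Sum>i<levels. a ^ (levels - Suc i)) = (\<Sum>i<levels. a ^ i)" by (rule sum.nat_diff_reindex)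
  also have "(\<Sum>i<levels. a ^ i) = (1 - a ^ levels) / (1 - a)" using a_less_1 by (simp add: sum_gp_strict)
  also have "\<dots> \<le> 1 / (1 - a)" using a_pos a_less_1 by (intro divide_right_mono) auto
  finally have "?H \<le> S + 1 / ((1 - a) * ln 2)" by (simp add: divide_right_mono)
  moreover have "l / 2 * (u * (1 - u)) \<le> l / 2 * (1 / 4)"
  proof (rule mult_left_mono)
    have "0 \<le> (u - 1 / 2)\<^sup>2" by simp
    then show "u * (1 - u) \<le> 1 / 4" by (simp add: power2_eq_square algebra_simps)
  qed (use l in simp)
  ultimately show "G \<le> l / 8 + 1 / ((1 - a) * ln 2)" using S unfolding G_def by linarith
qed

text \<open>Expanding the square in the two-sided bound leaves the constant
  \<open>1 / (2 * l) - 1 / 2\<close>, which joins the error.\<close>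

lemma metric_entropy_asymptotic:
  defines "X \<equiv> log 2 (1 / \<epsilon>)" and "l \<equiv> log 2 (1 / a)"
  assumes X: "1 < X"
  shows "\<bar>metric_entropy \<epsilon> (bump_class a) - (X\<^sup>2 / (2 * l) + (1/2 - 1 / l) * X)\<bar> \<le>
    l / 8 + 1 / ((1 - a) * ln 2) + 1 / (2 * l) + 1 / 2"
proof -
  have l: "0 < l" using log_inverse_a_pos by (simp add: l_def)
  have "(X - 1)\<^sup>2 / (2 * l) + (X - 1) / 2 = X\<^sup>2 / (2 * l) + (1/2 - 1 / l) * X + 1 / (2 * l) - 1 / 2"
    using l by (simp add: field_simps power2_eq_square)
  moreover have "0 < 1 / (2 * l)" using l by simp
  moreover note metric_entropy_bounds[OF X[unfolded X_def], folded X_def l_def]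
  ultimately show ?thesis by linarith
qed

end

section \<open>Assembly of the claims\<close>

theorem theorem4p2:
  shows
    "(\<forall>a\<in>{1/2<..<1::real}. \<forall>\<epsilon>>0.
        finite {k. 1 \<le> k \<and> 1 < radix a \<epsilon> k} \<and>
        covering_number \<epsilon> (bump_class a) = enat (\<Prod>k. radix a \<epsilon> (Suc k)) \<and>
        min_code_length \<epsilon> (bump_class a) =
          enat (nat \<lceil>\<Sum>k. log 2 (real (radix a \<epsilon> (Suc k)))\<rceil>)) \<and>
     (\<exists>W::nat. \<forall>a\<in>{1/2<..<1::real} \<inter> \<rat>. \<exists>K::real. \<forall>\<epsilon>>0.
        \<exists>B J D E R.
          enat B = min_code_length \<epsilon> (bump_class a) \<and>
          mixed_radix_code (radix a \<epsilon>) B (bump_class a) J D E R \<and>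
          distortion (bump_class a) E R \<le> ennreal \<epsilon> \<and>
          (\<forall>j\<in>digit_tuples (radix a \<epsilon>). \<exists>N.
             scalar_net N \<and> rational_net N \<and> (\<forall>x. net_fun N x = D j x) \<and>
             net_width N \<le> W \<and>
             real (net_depth N) \<le> K * (1 + log_plus (1 / \<epsilon>)) \<and>
             real (net_params N) \<le> K * (1 + log_plus (1 / \<epsilon>)))) \<and>
     (\<forall>a\<in>{1/2<..<1::real}. \<exists>K::real. \<forall>\<epsilon>>0.
        let X = log 2 (1 / \<epsilon>); lam = log 2 (1 / a) in
        X > 1 \<longrightarrow>
        \<bar>metric_entropy \<epsilon> (bump_class a) - (X\<^sup>2 / (2 * lam) + (1/2 - 1 / lam) * X)\<bar> \<le> K) \<and>
     (\<forall>a\<in>{1/2<..<1::real}. \<forall>\<epsilon>>0.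
        let X = log 2 (1 / \<epsilon>); lam = log 2 (1 / a);
            G = metric_entropy \<epsilon> (bump_class a) - (X - 1)\<^sup>2 / (2 * lam) - (X - 1) / 2 in
        X > 1 \<longrightarrow> 0 \<le> G \<and> G \<le> lam / 8 + 1 / ((1 - a) * ln 2))"
proof (intro conjI)
  show "\<forall>a\<in>{1/2<..<1::real}. \<forall>\<epsilon>>0.
      finite {k. 1 \<le> k \<and> 1 < radix a \<epsilon> k} \<and>
      covering_number \<epsilon> (bump_class a) = enat (\<Prod>k. radix a \<epsilon> (Suc k)) \<and>
      min_code_length \<epsilon> (bump_class a) = enat (nat \<lceil>\<Sum>k. log 2 (real (radix a \<epsilon> (Suc k)))\<rceil>)"
  proof (intro ballI allI impI)
    fix a \<epsilon> :: real assume "a \<in> {1/2<..<1}" "0 < \<epsilon>"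
    then interpret bump_quantizer a \<epsilon> by unfold_locales auto
    obtain E R where "min_code_length \<epsilon> (bump_class a) = enat (nat \<lceil>log 2 (real codewords)\<rceil>)"
      by (rule optimal_mixed_radix_code)
    then show "finite {k. 1 \<le> k \<and> 1 < radix a \<epsilon> k} \<and>
      covering_number \<epsilon> (bump_class a) = enat (\<Prod>k. radix a \<epsilon> (Suc k)) \<and>
      min_code_length \<epsilon> (bump_class a) = enat (nat \<lceil>\<Sum>k. log 2 (real (radix a \<epsilon> (Suc k)))\<rceil>)"
      by (simp only: radices_gt_1 finite_atLeastAtMost covering_number_bump_class prodinf_radix
          suminf_log_radix simp_thms)
  qed
next
  show "\<exists>W::nat. \<forall>a\<in>{1/2<..<1::real} \<inter> \<rat>. \<exists>K::real. \<forall>\<epsilon>>0.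
      \<exists>B J D E R.
        enat B = min_code_length \<epsilon> (bump_class a) \<and>
        mixed_radix_code (radix a \<epsilon>) B (bump_class a) J D E R \<and>
        distortion (bump_class a) E R \<le> ennreal \<epsilon> \<and>
        (\<forall>j\<in>digit_tuples (radix a \<epsilon>). \<exists>N.
           scalar_net N \<and> rational_net N \<and> (\<forall>x. net_fun N x = D j x) \<and>
           net_width N \<le> W \<and>
           real (net_depth N) \<le> K * (1 + log_plus (1 / \<epsilon>)) \<and>
           real (net_params N) \<le> K * (1 + log_plus (1 / \<epsilon>)))"
  proof (intro exI[of _ "5::nat"] ballI)
    fix a :: real assume a: "a \<in> {1/2<..<1} \<inter> \<rat>"
    show "\<exists>K::real. \<forall>\<epsilon>>0.
      \<exists>B J D E R.
        enat B = min_code_length \<epsilon> (bump_class a) \<and>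
        mixed_radix_code (radix a \<epsilon>) B (bump_class a) J D E R \<and>
        distortion (bump_class a) E R \<le> ennreal \<epsilon> \<and>
        (\<forall>j\<in>digit_tuples (radix a \<epsilon>). \<exists>N.
           scalar_net N \<and> rational_net N \<and> (\<forall>x. net_fun N x = D j x) \<and>
           net_width N \<le> 5 \<and>
           real (net_depth N) \<le> K * (1 + log_plus (1 / \<epsilon>)) \<and>
           real (net_params N) \<le> K * (1 + log_plus (1 / \<epsilon>)))"
    proof (intro exI[of _ "136 + 90 / log 2 (1 / a)"] allI impI)
      fix \<epsilon> :: real assume "0 < \<epsilon>"
      with a interpret bump_quantizer a \<epsilon> by unfold_locales auto
      obtain E R where code:
        "mixed_radix_code n (nat \<lceil>log 2 (real codewords)\<rceil>) (bump_class a) quantize reconstruct E R"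
        "distortion (bump_class a) E R \<le> ennreal \<epsilon>"
        "min_code_length \<epsilon> (bump_class a) = enat (nat \<lceil>log 2 (real codewords)\<rceil>)"
        by (rule optimal_mixed_radix_code)
      let ?K = "136 + 90 / log 2 (1 / a)"
      have net: "\<exists>N. scalar_net N \<and> rational_net N \<and> (\<forall>x. net_fun N x = reconstruct j x) \<and>
          net_width N \<le> 5 \<and> real (net_depth N) \<le> ?K * (1 + log_plus (1 / \<epsilon>)) \<and>
          real (net_params N) \<le> ?K * (1 + log_plus (1 / \<epsilon>))" for j
      proof -
        obtain N where "scalar_net N" "rational_net N" "\<And>x. net_fun N x = reconstruct j x"
          "net_width N \<le> 5" "real (net_depth N) \<le> ?K * (1 + log_plus (1 / \<epsilon>))"
          "real (net_params N) \<le> ?K * (1 + log_plus (1 / \<epsilon>))"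
          using reconstruct_net a by blast
        then show ?thesis by blast
      qed
      show "\<exists>B J D E R.
        enat B = min_code_length \<epsilon> (bump_class a) \<and>
        mixed_radix_code (radix a \<epsilon>) B (bump_class a) J D E R \<and>
        distortion (bump_class a) E R \<le> ennreal \<epsilon> \<and>
        (\<forall>j\<in>digit_tuples (radix a \<epsilon>). \<exists>N.
           scalar_net N \<and> rational_net N \<and> (\<forall>x. net_fun N x = D j x) \<and>
           net_width N \<le> 5 \<and>
           real (net_depth N) \<le> ?K * (1 + log_plus (1 / \<epsilon>)) \<and>
           real (net_params N) \<le> ?K * (1 + log_plus (1 / \<epsilon>)))"
        by (rule exI[of _ "nat \<lceil>log 2 (real codewords)\<rceil>"], rule exI[of _ quantize],
            rule exI[of _ reconstruct], rule exI[of _ E], rule exI[of _ R])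
           (intro conjI ballI code(1,2) code(3)[symmetric] net)
    qed
  qed
next
  show "\<forall>a\<in>{1/2<..<1::real}. \<exists>K::real. \<forall>\<epsilon>>0.
      let X = log 2 (1 / \<epsilon>); lam = log 2 (1 / a) in
      X > 1 \<longrightarrow>
      \<bar>metric_entropy \<epsilon> (bump_class a) - (X\<^sup>2 / (2 * lam) + (1/2 - 1 / lam) * X)\<bar> \<le> K"
    unfolding Let_def
  \<comment> \<open>The constant is introduced before \<epsilon> and is fixed by the bound shown
    below, which depends on \<open>a\<close> alone.\<close>
  proof (intro ballI exI allI impI)
    fix a \<epsilon> :: real assume "a \<in> {1/2<..<1}" "0 < \<epsilon>" and X: "1 < log 2 (1 / \<epsilon>)"
    then interpret bump_quantizer a \<epsilon> by unfold_locales auto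
    show "\<bar>metric_entropy \<epsilon> (bump_class a) - ((log 2 (1 / \<epsilon>))\<^sup>2 / (2 * log 2 (1 / a)) +
        (1/2 - 1 / log 2 (1 / a)) * log 2 (1 / \<epsilon>))\<bar> \<le>
        log 2 (1 / a) / 8 + 1 / ((1 - a) * ln 2) + 1 / (2 * log 2 (1 / a)) + 1 / 2"
      by (rule metric_entropy_asymptotic[OF X])
  qed
next
  show "\<forall>a\<in>{1/2<..<1::real}. \<forall>\<epsilon>>0.
      let X = log 2 (1 / \<epsilon>); lam = log 2 (1 / a);
          G = metric_entropy \<epsilon> (bump_class a) - (X - 1)\<^sup>2 / (2 * lam) - (X - 1) / 2 in
      X > 1 \<longrightarrow> 0 \<le> G \<and> G \<le> lam / 8 + 1 / ((1 - a) * ln 2)"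
    unfolding Let_def
  proof (intro ballI allI impI conjI)
    fix a \<epsilon> :: real assume "a \<in> {1/2<..<1}" "0 < \<epsilon>" and X: "1 < log 2 (1 / \<epsilon>)"
    then interpret bump_quantizer a \<epsilon> by unfold_locales auto
    let ?G = "metric_entropy \<epsilon> (bump_class a) - (log 2 (1 / \<epsilon>) - 1)\<^sup>2 / (2 * log 2 (1 / a)) -
        (log 2 (1 / \<epsilon>) - 1) / 2"
    show "0 \<le> ?G" by (rule metric_entropy_bounds(1)[OF X])
    show "?G \<le> log 2 (1 / a) / 8 + 1 / ((1 - a) * ln 2)" by (rule metric_entropy_bounds(2)[OF X])
  qed
qed

end
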